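(* Let $n\ge 2$ be an integer and let $K_n$ be the complete graph on $n$ vertices. Then: (i) the Randić characteristic polynomial of $K_n$ is $RP(K_n,\lambda)=(\lambda-1)\left(\lambda+\frac{1}{n-1}\right)^{n-1}$; (ii) the Randić energy of $K_n$ is $RE(K_n)=2$.
   Context: All graphs are finite and simple. For a graph $G$ with vertices $v_1,\dots,v_n$ of degrees $d_1,\dots,d_n$, the Randić matrix $R(G)$ is the $n\times n$ real symmetric matrix with $(i,j)$-entry $\frac{1}{\sqrt{d_id_j}}$ if $v_i$ and $v_j$ are adjacent, and $0$ otherwise. The Randić characteristic polynomial of $G$ is $RP(G,\lambda)=\det(\lambda I-R(G))$. The Randić energy of $G$ is $RE(G)=\sum_{i=1}^n|\rho_i|$, where $\rho_1,\dots,\rho_n$ are the eigenvalues of $R(G)$ counted with multiplicity. *)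

theory Defs
  imports
    "Graph_Theory.Kuratowski"
    "Jordan_Normal_Form.Char_Poly"
begin

text \<open>
  A finite simple graph is a \<^const>\<open>graph\<close>, i.e. a finite symmetric digraph without loops or
  multiple arcs; an undirected edge is a pair of opposite arcs, so the degree of a vertex is
  its out-degree. The list \<open>vs\<close> is the enumeration \<open>v\<^sub>1, \<dots>, v\<^sub>n\<close> of the vertices that
  indexes rows and columns.
\<close>

definition vertex_enum :: "('a, 'b) pre_digraph \<Rightarrow> 'a list \<Rightarrow> bool" where
  "vertex_enum G vs \<longleftrightarrow> distinct vs \<and> set vs = verts G"

definition randic_matrix :: "('a, 'b) pre_digraph \<Rightarrow> 'a list \<Rightarrow> real mat" where
  "randic_matrix G vs = mat (length vs) (length vs) (\<lambda>(i, j).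
     if vs ! i \<rightarrow>\<^bsub>G\<^esub> vs ! j
     then 1 / sqrt (real (out_degree G (vs ! i)) * real (out_degree G (vs ! j)))
     else 0)"

definition randic_char_poly :: "('a, 'b) pre_digraph \<Rightarrow> 'a list \<Rightarrow> real poly" where
  "randic_char_poly G vs = char_poly (randic_matrix G vs)"

text \<open>
  The matrix is real symmetric, so all its eigenvalues are real; the multiplicity of an
  eigenvalue is its order as a root of the characteristic polynomial.
\<close>

definition randic_energy :: "('a, 'b) pre_digraph \<Rightarrow> 'a list \<Rightarrow> real" where
  "randic_energy G vs =
     (\<Sum>\<rho> | eigenvalue (randic_matrix G vs) \<rho>.
        real (order \<rho> (char_poly (randic_matrix G vs))) * \<bar>\<rho>\<bar>)"

end

theory Submission
  imports Defs
begin

text \<open>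
  Every vertex of \<open>K\<^sub>n\<close> has degree \<open>n - 1\<close>, so the Randic matrix has zero diagonal and all
  other entries equal to \<open>1 / (n - 1)\<close>. Subtracting the first row from every other row and,
  conversely, adding all other columns to the first one is a similarity transformation that
  makes such a matrix upper triangular with diagonal \<open>1, -1 / (n - 1), \<dots>, -1 / (n - 1)\<close>.
\<close>

lemma char_poly_const_diag_const_off_diag:
  fixes a d :: "'a :: comm_ring_1"
  shows "char_poly (mat (Suc m) (Suc m) (\<lambda>(i, j). if i = j then d else a)) =
    [:- (d + of_nat m * a), 1:] * [:a - d, 1:] ^ m"
proof -
  let ?n = "Suc m"
  define A where "A = mat ?n ?n (\<lambda>(i, j). if i = j then d else a)"
  \<comment> \<open>The triangular form: its corner entry is the common row sum of \<open>A\<close>,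
    the eigenvalue of the all-ones vector.\<close>
  define B where "B = mat ?n ?n (\<lambda>(i, j).
    if i = 0 then if j = 0 then d + of_nat m * a else a else if i = j then d - a else 0)"
  \<comment> \<open>From the left, \<open>E c\<close> adds \<open>c\<close> times the first row to
    every other row; from the right, it adds \<open>c\<close> times the sum of the other columns to
    the first. These matrices multiply by adding their parameters.\<close>
  define E where "E c = mat ?n ?n (\<lambda>(i, j). if i = j then 1 else if j = 0 then c else 0)"
    for c :: 'a
  \<comment> \<open>The halfway matrix between \<open>A\<close> and \<open>B\<close>:
    \<open>A\<close> with its first column replaced by the row sums.\<close>
  define C where "C = mat ?n ?n (\<lambda>(i, j).
    if j = 0 then d + of_nat m * a else if i = j then d else a)"
  have if_mult: "(if P then x else y) * z = (if P then x * z else y * z)"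
    "z * (if P then x else y) = (if P then z * x else z * y)" for P and x y z :: 'a
    by auto
  note sum_Suc = sum.atLeast0_lessThan_Suc_shift
  have E_mult: "E c * E c' = 1\<^sub>m ?n" if "c + c' = 0" for c c'
  proof (rule eq_matI)
    fix i j assume ij: "i < dim_row (1\<^sub>m ?n)" "j < dim_col (1\<^sub>m ?n)"
    show "(E c * E c') $$ (i, j) = 1\<^sub>m ?n $$ (i, j)"
      using ij that by (cases i; cases j)
        (auto simp: E_def scalar_prod_def sum_Suc if_mult
          add.commute simp del: sum.op_ivl_Suc cong: if_cong)
  qed (auto simp: E_def)
  have EB: "E 1 * B = C"
  proof (rule eq_matI)
    fix i j assume ij: "i < dim_row C" "j < dim_col C"
    show "(E 1 * B) $$ (i, j) = C $$ (i, j)"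
      using ij by (cases i; cases j)
        (auto simp: E_def B_def C_def scalar_prod_def sum_Suc if_mult simp del: sum.op_ivl_Suc cong: if_cong)
  qed (auto simp: E_def B_def C_def)
  \<comment> \<open>The sum of a lower row of \<open>C\<close> without its first entry, with indices
    shifted by one. Subtracting it from \<open>d + of_nat m * a\<close> restores the entry
    \<open>a\<close> of \<open>A\<close>.\<close>
  have sum_row: "(\<Sum>k = 0..<m. if i = k then d else a) = d + of_nat m * a - a"
    if "i < m" for i
  proof -
    have "(\<Sum>k = 0..<m. if i = k then d else a) = (\<Sum>k = 0..<m. (if i = k then d - a else 0) + a)"
      by (rule sum.cong) auto
    also have "\<dots> = d + of_nat m * a - a"
      using that by (simp add: sum.distrib)
    finally show ?thesis .
  qed
  have CE: "C * E (- 1) = A"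
  proof (rule eq_matI)
    fix i j assume ij: "i < dim_row A" "j < dim_col A"
    show "(C * E (- 1)) $$ (i, j) = A $$ (i, j)"
      using ij by (cases i; cases j)
        (auto simp: E_def A_def C_def scalar_prod_def sum_Suc if_mult sum_negf sum_row simp del: sum.op_ivl_Suc cong: if_cong)
  qed (auto simp: E_def A_def C_def)
  have "similar_mat_wit A B (E 1) (E (- 1))"
    by (rule similar_mat_witI[of _ _ ?n])
      (auto simp: E_mult EB CE, auto simp: A_def B_def E_def)
  then have "char_poly A = char_poly B"
    by (intro char_poly_similar) (auto simp: similar_mat_def)
  also have "\<dots> = (\<Prod>b \<leftarrow> diag_mat B. [:- b, 1:])"
    by (rule char_poly_upper_triangular[of _ ?n]) (auto simp: B_def)
  also have "diag_mat B = (d + of_nat m * a) # replicate m (d - a)"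
    by (rule nth_equalityI)
      (auto simp: diag_mat_def B_def nth_Cons simp del: upt_Suc split: nat.split)
  finally show ?thesis
    by (simp add: A_def)
qed

text \<open>Without multiple arcs, \<open>head\<close> is injective on the arcs leaving
  \<open>v\<close>, and its image is the set of all other vertices.\<close>

lemma out_degree_complete_digraph:
  assumes "complete_digraph n G" and v: "v \<in> verts G"
  shows "out_degree G v = n - 1"
proof -
  from assms have G: "graph G" "card (verts G) = n"
    "arcs_ends G = {(u, w). (u, w) \<in> verts G \<times> verts G \<and> u \<noteq> w}"
    by (auto simp: complete_digraph_def)
  interpret graph G by fact
  have "inj_on (head G) (out_arcs G v)"
    by (rule inj_onI) (auto simp: arc_to_ends_def intro!: no_multi_arcs)
  moreover have "head G ` out_arcs G v = {w. (v, w) \<in> arcs_ends G}"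
    by (force simp: arcs_ends_conv)
  then have "head G ` out_arcs G v = verts G - {v}"
    using G v by auto
  ultimately show ?thesis
    using G v by (metis card_Diff_singleton card_image out_degree_def)
qed

lemma randic_matrix_complete_digraph:
  assumes K: "complete_digraph n G" and vs: "vertex_enum G vs"
  shows "randic_matrix G vs = mat n n (\<lambda>(i, j). if i = j then 0 else 1 / real (n - 1))"
proof -
  have len: "length vs = n" and vs': "distinct vs" "set vs = verts G"
    using K vs by (auto simp: complete_digraph_def vertex_enum_def distinct_card[symmetric])
  have mem: "vs ! i \<in> verts G" if "i < n" for i
    using that len vs' nth_mem by blast
  have adj: "vs ! i \<rightarrow>\<^bsub>G\<^esub> vs ! j \<longleftrightarrow> i \<noteq> j" if "i < n" "j < n" for i j
    using K mem that len vs' by (auto simp: complete_digraph_def nth_eq_iff_index_eq)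
  show ?thesis
    unfolding randic_matrix_def len
    by (rule eq_matI) (auto simp: adj mem out_degree_complete_digraph[OF K])
qed

lemma randic_char_poly_complete_digraph:
  assumes "n \<ge> 2" and "complete_digraph n G" and "vertex_enum G vs"
  shows "randic_char_poly G vs = [:- 1, 1:] * [:1 / (real n - 1), 1:] ^ (n - 1)"
proof -
  \<comment> \<open>With \<open>d = 0\<close> and \<open>a = 1 / m\<close>, the row sum
    \<open>m * a\<close> equals 1 because \<open>m > 0\<close>.\<close>
  obtain m where m: "n = Suc m" "m > 0"
    using assms(1) by (cases n) auto
  show ?thesis
    unfolding randic_char_poly_def randic_matrix_complete_digraph[OF assms(2,3)] m(1)
      char_poly_const_diag_const_off_diag
    using m(2) by simp
qed

theorem theorem4:
  fixes n :: nat and G :: "('a, 'b) pre_digraph" and vs :: "'a list"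
  assumes "n \<ge> 2"
    and "complete_digraph n G"
    and "vertex_enum G vs"
  shows "randic_char_poly G vs = [:- 1, 1:] * [:1 / (real n - 1), 1:] ^ (n - 1)
    \<and> randic_energy G vs = 2"
proof
  define c where "c = 1 / (real n - 1)"
  have c: "c > 0" "(real n - 1) * c = 1"
    using assms(1) by (auto simp: c_def)
  show RP: "randic_char_poly G vs = [:- 1, 1:] * [:1 / (real n - 1), 1:] ^ (n - 1)"
    using assms by (rule randic_char_poly_complete_digraph)
  then have cp: "char_poly (randic_matrix G vs) = [:- 1, 1:] * [:c, 1:] ^ (n - 1)"
    by (simp add: randic_char_poly_def c_def)
  have "randic_matrix G vs \<in> carrier_mat n n"
    by (simp add: randic_matrix_complete_digraph[OF assms(2,3)])
  \<comment> \<open>The exponent \<open>n - 1\<close> is positive, so \<open>- c\<close> is indeed a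
    root.\<close>
  then have "{\<rho>. eigenvalue (randic_matrix G vs) \<rho>} = {1, - c}"
    using assms(1) by (auto simp: eigenvalue_root_char_poly cp)
  moreover have "order \<rho> (char_poly (randic_matrix G vs)) =
      (if \<rho> = 1 then 1 else 0) + (if \<rho> = - c then n - 1 else 0)" for \<rho>
    using order_linear_power[of \<rho> "- 1" 1] order_linear_power[of \<rho> c "n - 1"]
    by (auto simp: cp order_mult simp del: mult_pCons_left)
  \<comment> \<open>As \<open>c > 0\<close>, the two eigenvalues differ and contribute 1 and
    \<open>(n - 1) * c = 1\<close>.\<close>
  ultimately show "randic_energy G vs = 2"
    using c assms(1) by (simp add: randic_energy_def)
qed

end
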